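(* Let $D$ be a super-orientation of $\overline{C_{2k+1}}$ for $k\geq 2$, with vertices labeled $x_0,\ldots,x_{2k}$ so that the complement of the underlying graph of $D$ is the cycle $(x_0,x_1,\ldots,x_{2k},x_0)$. Then $D$ has a path partition orthogonal to $\{x_0,x_{2k}\}$ if and only if $D$ is not isomorphic to $\vec{D}_{2k+1}$.
   Context: A super-orientation of a graph $G$ is a digraph obtained by replacing each edge $uv$ of $G$ by the arc $(u,v)$, the arc $(v,u)$, or both. $\overline{C_{2k+1}}$ denotes the complement of a cycle of length $2k+1$. The vertices of $D$ are labeled $x_0,\ldots,x_{2k}$ so that the complement of the underlying graph of $D$ is the cycle $(x_0,\ldots,x_{2k},x_0)$; thus the only non-neighbors of $x_i$ are $x_{i-1}$ and $x_{i+1}$ (indices modulo $2k+1$), and $\{x_0,x_{2k}\}$ is a maximum stable set. $\vec{D}_{2k+1}$ denotes such a super-orientation of $\overline{C_{2k+1}}$ (with this labeling) in which there is no arc $(x_j,x_i)$ for $0\le i<j\le 2k$. Paths in digraphs are directed paths. A path partition of $D$ is a collection of vertex-disjoint directed paths covering $V(D)$; a path partition $\mathcal{P}$ and a stable set $S$ are orthogonal if every path of $\mathcal{P}$ contains exactly one vertex of $S$.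
   Formalization: "Isomorphic" is taken to mean by an isomorphism carrying the stable set {x_0,x_{2k}} of D onto that of the labeled digraph; for plain digraph isomorphism the claim fails (rotating the labels of the 5-vertex digraph gives an orthogonal path partition). *)

theory Defs
  imports "Graph_Theory.Graph_Theory"
begin

(* Undirected graphs are symmetric loop-free pair digraphs: an edge uv is the pair of
   arcs (u,v), (v,u). The underlying graph of a digraph D is then mk_symmetric D. *)

definition complement_graph :: "'a pair_pre_digraph \<Rightarrow> 'a pair_pre_digraph" where
  "complement_graph G = \<lparr> pverts = pverts G,
     parcs = {(u, v). u \<in> pverts G \<and> v \<in> pverts G \<and> u \<noteq> v \<and> (u, v) \<notin> parcs G} \<rparr>"

definition cycle_graph :: "nat \<Rightarrow> (nat \<Rightarrow> 'a) \<Rightarrow> 'a pair_pre_digraph" where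
  "cycle_graph n x = \<lparr> pverts = x ` {..<n},
     parcs = (\<Union>i<n. {(x i, x (Suc i mod n)), (x (Suc i mod n), x i)}) \<rparr>"

(* The locale digraph excludes parallel arcs, so between adjacent vertices u, v there is
   (u,v), (v,u), or one arc of each kind. *)
definition super_orientation :: "('a, 'b) pre_digraph \<Rightarrow> 'a pair_pre_digraph \<Rightarrow> bool" where
  "super_orientation D G \<longleftrightarrow> pair_graph G \<and> digraph D \<and> mk_symmetric D = G"

(* A directed path is its nonempty list of distinct vertices; one-vertex paths count. *)
definition path_partition :: "('a, 'b) pre_digraph \<Rightarrow> 'a list set \<Rightarrow> bool" where
  "path_partition D P \<longleftrightarrow>
     (\<forall>p\<in>P. vpath p D) \<and>
     (\<forall>p\<in>P. \<forall>q\<in>P. p \<noteq> q \<longrightarrow> set p \<inter> set q = {}) \<and>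
     (\<Union>p\<in>P. set p) = verts D"

definition orthogonal_paths :: "'a list set \<Rightarrow> 'a set \<Rightarrow> bool" where
  "orthogonal_paths P S \<longleftrightarrow> (\<forall>p\<in>P. \<exists>!v. v \<in> set p \<and> v \<in> S)"

definition Dvec :: "nat \<Rightarrow> nat pair_pre_digraph" where
  "Dvec k = \<lparr> pverts = {..2 * k},
     parcs = {(i, j). i < j \<and> (i, j) \<in> parcs (complement_graph (cycle_graph (2 * k + 1) id))} \<rparr>"

(* Isomorphism of digraphs with a distinguished vertex set: this is digraph_iso G H with the
   additional requirement that the isomorphism carries S onto T. For S = {x_0, x_2k} and
   T = {0, 2k} it allows for reversing the labelling but not for rotating it: rotating the
   labels of Dvec k gives a digraph that does have a path partition orthogonal to {x_0, x_2k}. *)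
definition digraph_iso_on :: "('a, 'b) pre_digraph \<Rightarrow> 'a set \<Rightarrow> ('c, 'd) pre_digraph \<Rightarrow> 'c set \<Rightarrow> bool"
  where "digraph_iso_on G S H T \<longleftrightarrow>
    (\<exists>f. pre_digraph.digraph_isomorphism G f \<and> H = app_iso f G \<and> iso_verts f ` S = T)"

lemma parcs_cycle_graph:
  "(u, v) \<in> parcs (cycle_graph n x) \<longleftrightarrow>
   (\<exists>i<n. u = x i \<and> v = x (Suc i mod n) \<or> v = x i \<and> u = x (Suc i mod n))"
  unfolding cycle_graph_def pair_pre_digraph.select_convs
    UN_iff insert_iff empty_iff Pair_inject lessThan_iff by blast

lemma parcs_complement_graph:
  "(u, v) \<in> parcs (complement_graph G) \<longleftrightarrow>
   u \<in> pverts G \<and> v \<in> pverts G \<and> u \<noteq> v \<and> (u, v) \<notin> parcs G"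
  by (simp add: complement_graph_def)

lemma complement_underlying:
  assumes "super_orientation D (complement_graph (cycle_graph (2 * k + 1) x))"
    and inj: "inj_on x {..2 * k}" and "k \<ge> 1"
  shows "complement_graph (mk_symmetric D) = cycle_graph (2 * k + 1) x"
proof -
  define n where "n = 2 * k + 1"
  have n: "n \<ge> 3" "{..2 * k} = {..<n}" using assms(3) by (auto simp: n_def)
  let ?C = "cycle_graph n x"
  have eq: "mk_symmetric D = complement_graph ?C"
    using assms(1) unfolding super_orientation_def n_def by blast
  have C: "u \<in> pverts ?C \<and> v \<in> pverts ?C \<and> u \<noteq> v" if uv: "(u, v) \<in> parcs ?C" for u v
  proof -
    obtain i where i: "i < n"
      and d: "u = x i \<and> v = x (Suc i mod n) \<or> v = x i \<and> u = x (Suc i mod n)"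
      using uv unfolding parcs_cycle_graph by blast
    define j where "j = Suc i mod n"
    have j: "j < n" unfolding j_def using n by simp
    have "i \<noteq> j"
    proof (cases "Suc i = n")
      case True
      then show ?thesis using n by (simp add: j_def)
    next
      case False
      then have "Suc i < n" using i by simp
      then show ?thesis by (simp add: j_def)
    qed
    then have "x i \<noteq> x j" using inj i j n unfolding inj_on_def by auto
    moreover have "x i \<in> pverts ?C" "x j \<in> pverts ?C"
      using i j by (auto simp: cycle_graph_def)
    ultimately show ?thesis using d unfolding j_def[symmetric] by auto
  qed
  have "(u, v) \<in> parcs (complement_graph (complement_graph ?C)) \<longleftrightarrow> (u, v) \<in> parcs ?C" for u v
    using C[of u v] by (auto simp: parcs_complement_graph complement_graph_def)
  then have "parcs (complement_graph (complement_graph ?C)) = parcs ?C" by auto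
  then show ?thesis
    unfolding eq n_def[symmetric]
    by (intro pair_pre_digraph.equality) (simp_all add: complement_graph_def)
qed

lemma sym_complement_cycle:
  "(u, v) \<in> parcs (complement_graph (cycle_graph n x)) \<longleftrightarrow>
   (v, u) \<in> parcs (complement_graph (cycle_graph n x))"
  unfolding parcs_complement_graph parcs_cycle_graph by blast

lemma pair_graph_complement_cycle: "pair_graph (complement_graph (cycle_graph n x))"
proof -
  let ?G = "complement_graph (cycle_graph n x)"
  have fv: "finite (pverts ?G)"
    by (simp add: complement_graph_def cycle_graph_def)
  have "parcs ?G \<subseteq> pverts ?G \<times> pverts ?G"
    by (auto simp: complement_graph_def)
  then have fa: "finite (parcs ?G)"
    using fv finite_subset by blast
  show ?thesis
  proof
    show "finite (pverts ?G)" "finite (parcs ?G)" by (fact fv fa)+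
    show "symmetric ?G"
      using sym_complement_cycle[of _ _ n x] by (auto simp: symmetric_def sym_def)
  qed (auto simp: complement_graph_def)
qed

(* Dvec k is the unique super-orientation of the complement of the cycle (0,...,2k,0)
   without an arc (j,i), i < j. *)
lemma Dvec_unique:
  "H = Dvec k \<longleftrightarrow>
     super_orientation (with_proj H) (complement_graph (cycle_graph (2 * k + 1) id)) \<and>
     (\<forall>i j. i < j \<and> j \<le> 2 * k \<longrightarrow> (j, i) \<notin> parcs H)"
proof -
  let ?G = "complement_graph (cycle_graph (2 * k + 1) id)"
  have pv: "pverts ?G = {..2 * k}"
    unfolding complement_graph_def cycle_graph_def by (simp add: lessThan_Suc_atMost)
  have "u \<in> pverts ?G \<and> v \<in> pverts ?G \<and> u \<noteq> v" if "(u, v) \<in> parcs ?G" for u v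
    using that unfolding complement_graph_def by simp
  then have arcG: "u \<le> 2 * k \<and> v \<le> 2 * k \<and> u \<noteq> v" if "(u, v) \<in> parcs ?G" for u v
    using that unfolding pv by blast
  have sG: "(v, u) \<in> parcs ?G" if "(u, v) \<in> parcs ?G" for u v
    using that by (rule sym_complement_cycle[THEN iffD1])
  have ms: "parcs (mk_symmetric (with_proj H)) = parcs H \<union> (parcs H)\<inverse>" for H :: "nat pair_pre_digraph"
    by (auto simp: parcs_mk_symmetric)
  have 1: "super_orientation (with_proj (Dvec k)) ?G"
  proof -
    have sub: "parcs (Dvec k) \<subseteq> parcs ?G" by (auto simp: Dvec_def)
    have pD: "pverts (Dvec k) = {..2 * k}" by (simp add: Dvec_def)
    have subD: "parcs (Dvec k) \<subseteq> {..2 * k} \<times> {..2 * k}" using sub arcG by fast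
    have "pair_digraph (Dvec k)"
    proof
      show "finite (parcs (Dvec k))" using subD by (rule finite_subset) simp
      show "finite (pverts (Dvec k))" by (simp add: pD)
      fix e assume e: "e \<in> parcs (Dvec k)"
      show "fst e \<in> pverts (Dvec k)" "snd e \<in> pverts (Dvec k)"
        using e subD unfolding pD by auto
      show "fst e \<noteq> snd e" using e by (auto simp: Dvec_def)
    qed
    then interpret Dv: pair_digraph "Dvec k" .
    have "digraph (with_proj (Dvec k))" by unfold_locales
    moreover have "mk_symmetric (with_proj (Dvec k)) = ?G"
    proof (rule pair_pre_digraph.equality)
      show "parcs (mk_symmetric (with_proj (Dvec k))) = parcs ?G"
        unfolding ms
      proof (intro set_eqI iffI)
        fix e assume "e \<in> parcs (Dvec k) \<union> (parcs (Dvec k))\<inverse>"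
        then show "e \<in> parcs ?G" using sub sG by blast
      next
        fix e assume e: "e \<in> parcs ?G"
        obtain i j where ij: "e = (i, j)" by (cases e)
        have "(i, j) \<in> parcs ?G" "(j, i) \<in> parcs ?G" "i < j \<or> j < i"
          using e sG arcG[of i j] unfolding ij by auto
        then show "e \<in> parcs (Dvec k) \<union> (parcs (Dvec k))\<inverse>"
          unfolding ij Dvec_def by auto
      qed
      show "pverts (mk_symmetric (with_proj (Dvec k))) = pverts ?G"
        unfolding pv by (simp add: pD)
    qed simp
    ultimately show ?thesis
      using pair_graph_complement_cycle by (simp add: super_orientation_def)
  qed
  have 2: "H = Dvec k" if so: "super_orientation (with_proj H) ?G"
    and nb: "\<forall>i j. i < j \<and> j \<le> 2 * k \<longrightarrow> (j, i) \<notin> parcs H"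
  proof -
    have eq: "mk_symmetric (with_proj H) = ?G" using so by (simp add: super_orientation_def)
    have pH: "pverts H = {..2 * k}"
      using arg_cong[OF eq, of pverts] pv by simp
    have aH: "parcs H \<union> (parcs H)\<inverse> = parcs ?G"
      using arg_cong[OF eq, of parcs] unfolding ms .
    have "(i, j) \<in> parcs H \<longleftrightarrow> i < j \<and> (i, j) \<in> parcs ?G" for i j
      using aH nb arcG[of i j] by (metis Un_iff converse_iff linorder_neqE_nat)
    then have "parcs H = parcs (Dvec k)" by (auto simp: Dvec_def)
    then show ?thesis using pH by (intro pair_pre_digraph.equality) (auto simp: Dvec_def)
  qed
  have 3: "(j, i) \<notin> parcs (Dvec k)" if "i < j" for i j
    using that by (simp add: Dvec_def)
  show ?thesis using 1 2 3 by blast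
qed

end

theory Submission
  imports Defs
begin

text \<open>In \<open>Dvec k\<close> every directed path increases by at least 2 in each step, so a partition into
  two paths would have to alternate along \<open>0, \<dots>, 2k\<close> and put \<open>0\<close> and \<open>2k\<close> on the same path.

  Conversely, suppose that \<open>D\<close> has no orthogonal path partition. For each \<open>i < 2k\<close>, 2-colour the
  indices \<open>0, \<dots>, 2k\<close> so that \<open>i, i + 1\<close> is the only monochromatic consecutive pair; then \<open>0\<close> and
  \<open>2k\<close> get different colours. One class is semicomplete and hence has a Hamiltonian path. In the
  other only \<open>x\<^sub>i\<close> and \<open>x\<^sub>i\<^sub>+\<^sub>1\<close> are non-adjacent, and any path through both can be enlarged to
  a Hamiltonian path by inserting the other vertices, so there is no such path. The absence of
  paths of length 2 shows that the direction of the arcs between \<open>x\<^sub>a\<close> and \<open>x\<^sub>b\<close> is unique and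
  depends only on \<open>\<lfloor>(b - a) / 2\<rfloor>\<close>, and the absence of paths of length 3 that it does not
  depend on this number either. Thus all arcs increase or all arcs decrease the index.\<close>

section \<open>Hamiltonian paths and the insertion of vertices\<close>

definition traceable :: "('a \<Rightarrow> 'a \<Rightarrow> bool) \<Rightarrow> 'a set \<Rightarrow> bool" where
  "traceable R S \<longleftrightarrow> (\<exists>p. distinct p \<and> successively R p \<and> set p = S)"

lemma traceableI: "distinct p \<Longrightarrow> successively R p \<Longrightarrow> set p = S \<Longrightarrow> traceable R S"
  by (auto simp: traceable_def)

text \<open>Place \<open>z\<close> before the first vertex of the path to which it has an arc, or at
  the end if there is none; the vertex preceding that place receives no arc from \<open>z\<close>,
  so it has an arc to \<open>z\<close>.\<close>

lemma traceable_insert: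
  assumes "traceable R S" and "z \<notin> S" and "\<And>y. y \<in> S \<Longrightarrow> R z y \<or> R y z"
  shows "traceable R (insert z S)"
proof -
  \<comment> \<open>The bound on \<open>hd q\<close> is what lets the induction prepend the next
    vertex: it has an arc to the old head and, in the recursive case, also to
    \<open>z\<close>.\<close>
  have *: "\<exists>q. distinct q \<and> successively R q \<and> set q = insert z (set p) \<and> hd q \<in> {z, hd p}"
    if "distinct p" "successively R p" "z \<notin> set p" "\<And>y. y \<in> set p \<Longrightarrow> R z y \<or> R y z" for p
    using that
  proof (induction p)
    case Nil
    then show ?case by (intro exI[of _ "[z]"]) auto
  next
    case (Cons y ys)
    show ?case
    proof (cases "R z y")
      case True
      then show ?thesis
        using Cons.prems by (intro exI[of _ "z # y # ys"]) auto
    next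
      case False
      then have yz: "R y z" using Cons.prems(4) by auto
      obtain q where q: "distinct q" "successively R q" "set q = insert z (set ys)"
        "hd q \<in> {z, hd ys}"
        using Cons by (auto simp: successively_Cons)
      show ?thesis
      proof (intro exI[of _ "y # q"] conjI)
        have "q \<noteq> []" using q(3) by auto
        moreover have "R y (hd q)"
        proof (cases "hd q = z")
          case False
          then have "hd q = hd ys" using q(4) by simp
          moreover have "ys \<noteq> []"
            using q(3) \<open>q \<noteq> []\<close> False list.set_sel(1)[of q] by auto
          ultimately show ?thesis using Cons.prems(2) by (auto simp: successively_Cons)
        qed (use yz in simp)
        ultimately show "successively R (y # q)" using q(2) by (simp add: successively_Cons)
      qed (use q Cons.prems in auto)
    qed
  qed
  obtain p where "distinct p" "successively R p" "set p = S"
    using assms(1) by (auto simp: traceable_def)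
  with *[of p] assms(2,3) show ?thesis by (auto simp: traceable_def)
qed

text \<open>The vertices of \<open>T - S\<close> are inserted one at a time, so pairs inside
  \<open>S\<close> may be non-adjacent. For \<open>S = {}\<close>, which the empty list traces, this
  yields Hamiltonian paths of semicomplete digraphs.\<close>

lemma traceable_extend:
  assumes "traceable R S" and "S \<subseteq> T" and "finite T"
    and "\<And>y z. z \<in> T - S \<Longrightarrow> y \<in> T \<Longrightarrow> y \<noteq> z \<Longrightarrow> R z y \<or> R y z"
  shows "traceable R T"
proof -
  have "traceable R (S \<union> W)" if "finite W" "W \<subseteq> T - S" for W
    using that
  proof (induction W rule: finite_induct)
    case (insert z W)
    then have "traceable R (insert z (S \<union> W))"
      using assms(2) by (intro traceable_insert assms(4)) auto
    then show ?case by simp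
  qed (use assms(1) in simp)
  from this[of "T - S"] show ?thesis
    using assms(2,3) by (simp add: Un_absorb1)
qed

section \<open>Index relations admitting no orthogonal partition\<close>

text \<open>\<open>A a b\<close> stands for an arc from the vertex of index \<open>a\<close> to that
  of index \<open>b\<close>. The third premise of \<open>adj\<close> excludes the closing edge
  \<open>0, 2k\<close> of the complementary cycle.\<close>

locale unpartitioned =
  fixes A :: "nat \<Rightarrow> nat \<Rightarrow> bool" and k :: nat
  assumes adj: "a + 2 \<le> b \<Longrightarrow> b \<le> 2 * k \<Longrightarrow> 0 < a \<or> b < 2 * k \<Longrightarrow> A a b \<or> A b a"
    and not_partition: "S \<inter> T = {} \<Longrightarrow> S \<union> T = {..2 * k} \<Longrightarrow> 0 \<in> S \<Longrightarrow> 2 * k \<in> T \<Longrightarrow>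
      traceable A S \<Longrightarrow> traceable A T \<Longrightarrow> False"
begin

text \<open>The colour class of \<open>i\<close> in the 2-colouring of \<open>0, \<dots>, 2k\<close> whose only monochromatic
  consecutive pair is \<open>i, i + 1\<close>.\<close>
definition side :: "nat \<Rightarrow> nat set" where
  "side i = {j. j \<le> 2 * k \<and> (j \<le> i \<longleftrightarrow> even (i + j))}"

text \<open>Non-adjacent indices are cyclically consecutive. Among these only \<open>i\<close> and
  \<open>i + 1\<close> share a colour, and their class is the one with \<open>c = True\<close>; the
  closing pair \<open>0, 2k\<close> is bichromatic because \<open>i < 2k\<close>.\<close>

lemma adjacent_same_colour:
  assumes i: "i < 2 * k" and le: "y \<le> 2 * k" "z \<le> 2 * k" and "y \<noteq> z"
    and col: "(y \<le> i \<longleftrightarrow> even (i + y)) = c" "(z \<le> i \<longleftrightarrow> even (i + z)) = c"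
    and "c \<Longrightarrow> z \<noteq> i \<and> z \<noteq> Suc i"
  shows "A y z \<or> A z y"
proof -
  have *: "A u v \<or> A v u"
    if uv: "u < v" "v \<le> 2 * k" "(u \<le> i \<longleftrightarrow> even (i + u)) = c" "(v \<le> i \<longleftrightarrow> even (i + v)) = c"
      and "\<not> (c \<and> u = i \<and> v = Suc i)" for u v
  proof (rule adj)
    have "v \<noteq> Suc u"
    proof
      assume v: "v = Suc u"
      then consider "v \<le> i" | "u = i" | "i < u" by linarith
      then show False using uv(3,4) that(5) v by cases auto
    qed
    then show "u + 2 \<le> v" using uv(1) by simp
    show "0 < u \<or> v < 2 * k"
    proof (rule ccontr)
      assume "\<not> (0 < u \<or> v < 2 * k)"
      then have "u = 0" "v = 2 * k" using uv(2) by auto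
      then show False using uv(3,4) i by auto
    qed
  qed fact
  show ?thesis
    using *[of y z] *[of z y] assms by (cases "y < z") auto
qed

lemma adjacent_side:
  assumes "i < 2 * k" "z \<in> side i" "y \<in> side i" "y \<noteq> z" "z \<noteq> i" "z \<noteq> Suc i"
  shows "A z y \<or> A y z"
  using adjacent_same_colour[of i y z True] assms by (auto simp: side_def)

text \<open>The only non-adjacent pair of \<open>side i\<close> lies in \<open>S\<close>, so a path
  through \<open>S\<close> extends to all of \<open>side i\<close>; together with a Hamiltonian path
  of the other class this gives a forbidden partition.\<close>

lemma not_traceable_side:
  assumes i: "i < 2 * k" and S: "S \<subseteq> side i" "i \<in> S" "Suc i \<in> S"
  shows "\<not> traceable A S"
proof
  assume "traceable A S"
  have "traceable A (side i)"
    using \<open>traceable A S\<close> S(1)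
  proof (rule traceable_extend)
    show "finite (side i)" by (rule finite_subset[of _ "{..2 * k}"]) (auto simp: side_def)
    show "A z y \<or> A y z" if "z \<in> side i - S" "y \<in> side i" "y \<noteq> z" for y z
      using adjacent_side[OF i] that S by blast
  qed
  define T where "T = {..2 * k} - side i"
  have adjT: "A z y \<or> A y z" if "z \<in> T" "y \<in> T" "y \<noteq> z" for y z
    using adjacent_same_colour[of i y z False] i that by (auto simp: T_def side_def)
  have "traceable A {}" by (rule traceableI[of "[]"]) auto
  then have "traceable A T"
    by (rule traceable_extend) (use adjT in \<open>auto simp: T_def\<close>)
  show False
  \<comment> \<open>The parity of \<open>i\<close> decides which class contains \<open>0\<close>: it
    is \<open>side i\<close> for even \<open>i\<close> and \<open>T\<close> for odd
    \<open>i\<close>.\<close>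
  proof (cases "even i")
    case True
    show False
      by (rule not_partition[of "side i" T])
        (use True i \<open>traceable A T\<close> \<open>traceable A (side i)\<close> in \<open>auto simp: side_def T_def\<close>)
  next
    case False
    show False
      by (rule not_partition[of T "side i"])
        (use False i \<open>traceable A T\<close> \<open>traceable A (side i)\<close> in \<open>auto simp: side_def T_def\<close>)
  qed
qed

lemma no_path_across:
  assumes "i < 2 * k" and "w \<in> side i" and "w \<noteq> i" "w \<noteq> Suc i"
  shows "\<not> (A i w \<and> A w (Suc i))" and "\<not> (A (Suc i) w \<and> A w i)"
    and "w' \<in> side i \<Longrightarrow> w' \<noteq> i \<Longrightarrow> w' \<noteq> Suc i \<Longrightarrow> w' \<noteq> w \<Longrightarrow>
      \<not> (A i w \<and> A w w' \<and> A w' (Suc i))"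
proof -
  have *: "i \<in> side i" "Suc i \<in> side i" using assms(1) by (auto simp: side_def)
  show "\<not> (A i w \<and> A w (Suc i))"
    using not_traceable_side[of i "set [i, w, Suc i]"] assms *
      traceableI[of "[i, w, Suc i]" A] by auto
  show "\<not> (A (Suc i) w \<and> A w i)"
    using not_traceable_side[of i "set [Suc i, w, i]"] assms *
      traceableI[of "[Suc i, w, i]" A] by auto
  show "\<not> (A i w \<and> A w w' \<and> A w' (Suc i))"
    if "w' \<in> side i" "w' \<noteq> i" "w' \<noteq> Suc i" "w' \<noteq> w"
    using not_traceable_side[of i "set [i, w, w', Suc i]"] assms * that
      traceableI[of "[i, w, w', Suc i]" A] by auto
qed

section \<open>Propagating the direction of arcs\<close>

lemma uniform_direction:
  assumes "i < 2 * k" and "w \<in> side i" and "w \<noteq> i" "w \<noteq> Suc i"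
  shows "A w i \<longleftrightarrow> A w (Suc i)" and "A i w \<longleftrightarrow> \<not> A w i" and "A (Suc i) w \<longleftrightarrow> \<not> A w i"
proof -
  have "i \<in> side i" "Suc i \<in> side i" using assms(1) by (auto simp: side_def)
  then have "A w i \<or> A i w" "A w (Suc i) \<or> A (Suc i) w"
    using adjacent_side[OF assms(1,2)] assms(3,4) by metis+
  then show "A w i \<longleftrightarrow> A w (Suc i)" "A i w \<longleftrightarrow> \<not> A w i" "A (Suc i) w \<longleftrightarrow> \<not> A w i"
    using no_path_across(1,2)[OF assms] by blast+
qed

text \<open>Here the monochromatic pair is \<open>a + 2m, a + 2m + 1\<close>, seen from
  \<open>a\<close>; in \<open>shift_odd\<close> it is \<open>a, a + 1\<close>, seen from
  \<open>a + 2m + 1\<close>.\<close>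

lemma shift_even:
  assumes "0 < m" and "a + 2 * m < 2 * k"
  shows "A a (a + 2 * m) \<longleftrightarrow> A a (Suc (a + 2 * m))"
    and "A (a + 2 * m) a \<longleftrightarrow> \<not> A a (a + 2 * m)"
    and "A (Suc (a + 2 * m)) a \<longleftrightarrow> \<not> A a (a + 2 * m)"
  using uniform_direction[of "a + 2 * m" a] assms by (auto simp: side_def)

lemma shift_odd:
  assumes "0 < m" and "a + 2 * m < 2 * k"
  shows "A a (Suc (a + 2 * m)) \<longleftrightarrow> A (Suc a) (Suc (a + 2 * m))"
    and "A (Suc (a + 2 * m)) (Suc a) \<longleftrightarrow> \<not> A (Suc a) (Suc (a + 2 * m))"
  using uniform_direction[of a "Suc (a + 2 * m)"] assms by (auto simp: side_def)

text \<open>Moving first the upper index by \<open>shift_even\<close> and then the lower one by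
  \<open>shift_odd\<close> translates the pair \<open>a, a + 2m\<close> by 1.\<close>

lemma direction_from_0:
  assumes "0 < m" "m < k" and "a + 2 * m \<le> 2 * k"
  shows "A a (a + 2 * m) \<longleftrightarrow> A 0 (2 * m)"
  using assms(3)
proof (induction a)
  case (Suc a)
  then show ?case using shift_even(1)[of m a] shift_odd(1)[of m a] assms(1) by simp
qed simp

lemma direction_0:
  assumes "m < k" and "0 < m"
  shows "A 0 (2 * m) \<longleftrightarrow> A 0 2"
  using assms
proof (induction m)
  case (Suc m)
  show ?case
  proof (cases "m = 0")
    case False
    define i where "i = 2 * Suc m"
    have i: "i < 2 * k" "2 < i" "even i" using Suc.prems False by (auto simp: i_def)
    have side: "0 \<in> side i" "2 \<in> side i" using i by (auto simp: side_def)
    have IH: "A 0 (2 * m) \<longleftrightarrow> A 0 2" using Suc False by simp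
    have 2: "A 2 i \<longleftrightarrow> A 0 2"
      using direction_from_0[of m 2] IH Suc.prems False by (simp add: i_def)
    have "A (0 + 2 * 1) 0 \<longleftrightarrow> \<not> A 0 (0 + 2 * 1)" by (rule shift_even) (use i in auto)
    then have "A 2 0 \<longleftrightarrow> \<not> A 0 2" unfolding add_0 mult_1_right .
    \<comment> \<open>Otherwise a path of length 3 arises: \<open>i, 0, 2, i + 1\<close> if
      \<open>A 0 2\<close> holds, and \<open>i, 2, 0, i + 1\<close> if it fails.\<close>
    then have "A 0 i \<longleftrightarrow> A 0 2"
      using 2 uniform_direction[OF i(1) side(1)] uniform_direction[OF i(1) side(2)]
        no_path_across(3)[OF i(1) side(1) _ _ side(2)]
        no_path_across(3)[OF i(1) side(2) _ _ side(1)] i(2) by auto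
    then show ?thesis by (simp add: i_def)
  qed simp
qed simp

lemma all_arcs_same_direction:
  assumes "a + 2 \<le> b" "b \<le> 2 * k" "0 < a \<or> b < 2 * k"
  shows "A a b \<longleftrightarrow> A 0 2" and "A b a \<longleftrightarrow> \<not> A 0 2"
proof -
  define m where "m = (b - a) div 2"
  have m: "0 < m" "m < k" using assms by (auto simp: m_def)
  have "(A a b \<longleftrightarrow> A 0 2) \<and> (A b a \<longleftrightarrow> \<not> A 0 2)"
  proof (cases "even (b - a)")
    case True
    then have b: "b = a + 2 * m" using assms(1) by (simp add: m_def)
    have ab: "A a b \<longleftrightarrow> A 0 2"
      using direction_from_0[OF m, of a] direction_0[OF m(2,1)] assms(2) b by simp
    moreover have "A b a \<longleftrightarrow> \<not> A a b"
    proof (cases "b < 2 * k")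
      case True
      then show ?thesis using shift_even(2)[of m a] m b by simp
    next
      case False
      \<comment> \<open>For \<open>b = 2k\<close> there is no index \<open>b + 1\<close> to pair
        with \<open>b\<close>, but then \<open>a > 0\<close>, and the pair \<open>a - 1, a\<close>
        serves instead.\<close>
      then obtain a' where "a = Suc a'" using assms by (cases a) auto
      then show ?thesis using shift_odd(2)[of m a'] m b assms(2) by simp
    qed
    ultimately show ?thesis by simp
  next
    case False
    then have b: "b = Suc (a + 2 * m)" using assms(1) unfolding m_def by presburger
    then show ?thesis
      using shift_even[of m a] direction_from_0[OF m, of a] direction_0[OF m(2,1)] m assms(2)
      by simp
  qed
  then show "A a b \<longleftrightarrow> A 0 2" "A b a \<longleftrightarrow> \<not> A 0 2" by blast+
qed

end

section \<open>Digraph paths, and adjacency in the complement of the cycle\<close>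

lemma set_vwalk_arcs_subset_iff:
  "set (vwalk_arcs p) \<subseteq> E \<longleftrightarrow> successively (\<lambda>u v. (u, v) \<in> E) p"
  by (induction p rule: vwalk_arcs.induct) auto

lemma vpath_iff_successively:
  "vpath p G \<longleftrightarrow>
    set p \<subseteq> verts G \<and> successively (\<lambda>u v. (u, v) \<in> arcs_ends G) p \<and> p \<noteq> [] \<and> distinct p"
  by (auto simp: vpath_def vwalk_def set_vwalk_arcs_subset_iff)

lemma path_partition_pairI:
  assumes "vpath p D" "vpath q D" "set p \<inter> set q = {}" "set p \<union> set q = verts D"
    and "u \<in> set p" "v \<in> set q"
  shows "\<exists>P. path_partition D P \<and> orthogonal_paths P {u, v}"
proof (intro exI conjI)
  show "path_partition D {p, q}"
    using assms by (auto simp: path_partition_def)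
  show "orthogonal_paths {p, q} {u, v}"
    using assms unfolding orthogonal_paths_def by blast
qed

lemma parcs_cycle_complement:
  assumes "inj_on x {..2 * k}" "a < b" "b \<le> 2 * k"
  shows "(x a, x b) \<in> parcs (complement_graph (cycle_graph (2 * k + 1) x)) \<longleftrightarrow>
    a + 2 \<le> b \<and> (0 < a \<or> b < 2 * k)"
proof -
  have eq: "x i = x j \<longleftrightarrow> i = j" if "i \<le> 2 * k" "j \<le> 2 * k" for i j
    using assms(1) that by (auto simp: inj_on_def)
  \<comment> \<open>Since \<open>a < b\<close>, each cycle edge can match in one order only;
    \<open>i = 2k\<close> is the closing edge, whose smaller index is its second end.\<close>
  have "(x a, x b) \<in> parcs (cycle_graph (2 * k + 1) x) \<longleftrightarrow>
    (\<exists>i\<le>2 * k. if i = 2 * k then a = 0 \<and> b = 2 * k else a = i \<and> b = Suc i)"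
    (is "?L \<longleftrightarrow> (\<exists>i\<le>2 * k. ?R i)")
  proof -
    have "(x a = x i \<and> x b = x (Suc i mod (2 * k + 1)) \<or> x b = x i \<and> x a = x (Suc i mod (2 * k + 1)))
       \<longleftrightarrow> ?R i" if "i \<le> 2 * k" for i
      using assms(2,3) that eq by (cases "i = 2 * k") auto
    moreover have "i < 2 * k + 1 \<longleftrightarrow> i \<le> 2 * k" for i by auto
    ultimately show ?thesis unfolding parcs_cycle_graph by blast
  qed
  also have "\<dots> \<longleftrightarrow> b = Suc a \<or> a = 0 \<and> b = 2 * k"
  proof
    assume "b = Suc a \<or> a = 0 \<and> b = 2 * k"
    then show "\<exists>i\<le>2 * k. ?R i"
    proof
      assume "b = Suc a"
      then show ?thesis using assms(3) by (intro exI[of _ a]) simp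
    next
      assume "a = 0 \<and> b = 2 * k"
      then show ?thesis by (intro exI[of _ "2 * k"]) simp
    qed
  qed (auto split: if_splits)
  finally show ?thesis
    using assms(2,3) eq[of a b] by (auto simp: parcs_complement_graph cycle_graph_def)
qed

lemma parcs_Dvec:
  "(a, b) \<in> parcs (Dvec k) \<longleftrightarrow> a + 2 \<le> b \<and> b \<le> 2 * k \<and> (0 < a \<or> b < 2 * k)"
proof (cases "a < b \<and> b \<le> 2 * k")
  case True
  then show ?thesis
    using parcs_cycle_complement[of id k a b] by (simp add: Dvec_def)
next
  case False
  then show ?thesis
    by (auto simp: Dvec_def parcs_complement_graph cycle_graph_def)
qed

section \<open>Increasing digraphs have no orthogonal partition\<close>

lemma no_partition_if_increasing:
  fixes g :: "'a \<Rightarrow> nat"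
  assumes P: "path_partition D P" "orthogonal_paths P S"
    and S: "S \<subseteq> verts D" "g ` verts D = {..2 * k}" "g ` S = {0, 2 * k}" and "0 < k"
    and inj: "inj_on g (verts D)"
    and incr: "\<And>u v. (u, v) \<in> arcs_ends D \<Longrightarrow> g u + 2 \<le> g v"
  shows False
proof -
  obtain s t where st: "s \<in> S" "g s = 0" "t \<in> S" "g t = 2 * k"
    using S(3) by (metis imageE insertI1 insertI2)
  have S2: "v = s \<or> v = t" if "v \<in> S" for v
  proof -
    have "g v = g s \<or> g v = g t" using that S(3) st by auto
    then show ?thesis using inj_onD[OF inj] S(1) st that by blast
  qed
  have paths: "vpath p D" if "p \<in> P" for p using P(1) that by (simp add: path_partition_def)
  have disj: "p = q" if "p \<in> P" "q \<in> P" "v \<in> set p" "v \<in> set q" for p q v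
    using P(1) that by (auto simp: path_partition_def)
  have cover: "\<exists>p\<in>P. v \<in> set p" if "v \<in> verts D" for v
    using P(1) that by (auto simp: path_partition_def)
  have uniq: "\<exists>!v. v \<in> set p \<and> v \<in> S" if "p \<in> P" for p
    using P(2) that by (simp add: orthogonal_paths_def)
  obtain p where p: "p \<in> P" "s \<in> set p" using cover st(1) S(1) by blast
  obtain q where q: "q \<in> P" "t \<in> set q" using cover st(3) S(1) by blast
  have "s \<noteq> t" using st \<open>0 < k\<close> by auto
  then have "t \<notin> set p" using uniq[OF p(1)] p(2) st by blast
  \<comment> \<open>Every path meets \<open>S\<close>, hence contains \<open>s\<close> or
    \<open>t\<close>; disjointness leaves only \<open>p\<close> and \<open>q\<close>.\<close>
  have pq: "r = p \<or> r = q" if "r \<in> P" for r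
    using uniq[OF that] S2 disj that p q by blast
  \<comment> \<open>Increasing by at least 2 is transitive, so the bound passes from consecutive
    vertices to any two vertices of a path.\<close>
  have far: "g u + 2 \<le> g v \<or> g v + 2 \<le> g u" if "r \<in> P" "u \<in> set r" "v \<in> set r" "u \<noteq> v" for r u v
  proof -
    have "successively (\<lambda>u v. g u + 2 \<le> g v) r"
      using paths[OF that(1)] incr by (auto simp: vpath_iff_successively elim!: successively_mono)
    then have "sorted_wrt (\<lambda>u v. g u + 2 \<le> g v) r"
      by (subst (asm) successively_conv_sorted_wrt) (auto intro!: transpI)
    then show ?thesis using that(2-4) by (induction r) auto
  qed
  \<comment> \<open>Vertices with consecutive labels lie on different paths, so membership in
    \<open>p\<close> alternates; at the even label \<open>2k\<close> this puts \<open>t\<close> on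
    \<open>p\<close>.\<close>
  have "\<forall>v\<in>verts D. g v = i \<longrightarrow> (v \<in> set p \<longleftrightarrow> even i)" if "i \<le> 2 * k" for i
    using that
  proof (induction i)
    case 0
    have "v = s" if "v \<in> verts D" "g v = 0" for v
      using inj_onD[OF inj, of v s] that st S(1) by auto
    then show ?case using p(2) by auto
  next
    case (Suc i)
    have "i \<in> g ` verts D" using S(2) Suc.prems by simp
    then obtain u where u: "u \<in> verts D" "g u = i" by auto
    have IH: "u \<in> set p \<longleftrightarrow> even i" using Suc.IH Suc.prems u by simp
    have "v \<in> set p \<longleftrightarrow> even (Suc i)" if v: "v \<in> verts D" "g v = Suc i" for v
    proof -
      have apart: "\<not> (u \<in> set r \<and> v \<in> set r)" if "r \<in> P" for r
        using far[OF that, of u v] u v by fastforce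
      have "u \<in> set p \<longleftrightarrow> v \<notin> set p"
        using apart[OF p(1)] apart[OF q(1)] cover[OF u(1)] cover[OF v(1)] pq by blast
      then show ?thesis using IH by simp
    qed
    then show ?case by blast
  qed
  from this[of "2 * k"] have "\<forall>v\<in>verts D. g v = 2 * k \<longrightarrow> v \<in> set p" by simp
  then show False
    using st(3,4) S(1) \<open>t \<notin> set p\<close> by blast
qed

section \<open>Isomorphisms with \<open>Dvec k\<close>\<close>

lemma iso_Dvec_increasing:
  assumes "digraph_iso_on D S (with_proj (Dvec k)) T"
  obtains g where "inj_on g (verts D)" "g ` verts D = {..2 * k}" "g ` S = T"
    "\<And>u v. (u, v) \<in> arcs_ends D \<Longrightarrow> g u + 2 \<le> g v"
proof -
  obtain f where f: "pre_digraph.digraph_isomorphism D f" "with_proj (Dvec k) = app_iso f D"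
    "iso_verts f ` S = T"
    using assms by (auto simp: digraph_iso_on_def)
  have sel: "{..2 * k} = iso_verts f ` verts D" "parcs (Dvec k) = iso_arcs f ` arcs D"
    "fst = iso_tail f" "snd = iso_head f"
    using arg_cong[OF f(2), of verts] arg_cong[OF f(2), of arcs]
      arg_cong[OF f(2), of tail] arg_cong[OF f(2), of head] by (simp_all add: Dvec_def)
  show thesis
  proof (rule that[of "iso_verts f"])
    show "inj_on (iso_verts f) (verts D)"
      using f(1) by (simp add: pre_digraph.digraph_isomorphism_def)
    fix u v assume "(u, v) \<in> arcs_ends D"
    then obtain e where e: "e \<in> arcs D" "u = tail D e" "v = head D e"
      by (auto simp: arcs_ends_conv)
    then have "iso_arcs f e = (iso_verts f u, iso_verts f v)"
      using f(1) sel(3,4) by (auto simp: pre_digraph.digraph_isomorphism_def prod_eq_iff)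
    then show "iso_verts f u + 2 \<le> iso_verts f v"
      using sel(2) e(1) by (metis imageI parcs_Dvec)
  qed (use sel f in auto)
qed

text \<open>Arcs of \<open>Dvec k\<close> are pairs of vertices, so the vertex map forces the arc
  map \<open>h\<close>; it is injective because \<open>D\<close> has no parallel arcs.\<close>

lemma iso_DvecI:
  assumes "digraph D" and "inj_on g (verts D)" "g ` verts D = {..2 * k}" "g ` S = T"
    and arcs: "\<And>u v. u \<in> verts D \<Longrightarrow> v \<in> verts D \<Longrightarrow>
      (u, v) \<in> arcs_ends D \<longleftrightarrow> (g u, g v) \<in> parcs (Dvec k)"
  shows "digraph_iso_on D S (with_proj (Dvec k)) T"
proof -
  interpret digraph D by fact
  define h where "h e = (g (tail D e), g (head D e))" for e
  define f where "f = \<lparr>iso_verts = g, iso_arcs = h, iso_head = snd, iso_tail = fst\<rparr>"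
  have "inj_on h (arcs D)"
  proof (rule inj_onI)
    fix e e' assume e: "e \<in> arcs D" "e' \<in> arcs D" "h e = h e'"
    then have "arc_to_ends D e = arc_to_ends D e'"
      using assms(2) by (auto simp: h_def arc_to_ends_def inj_on_def)
    then show "e = e'" using e no_multi_arcs by blast
  qed
  then have "digraph_isomorphism f"
    using assms(2) wf_digraph by (simp add: digraph_isomorphism_def f_def h_def)
  moreover have "h ` arcs D = parcs (Dvec k)"
  proof (intro equalityI subsetI)
    fix z assume "z \<in> h ` arcs D"
    then obtain e where e: "e \<in> arcs D" "z = h e" by auto
    then have "(tail D e, head D e) \<in> arcs_ends D" by (auto simp: arcs_ends_conv)
    then show "z \<in> parcs (Dvec k)" using arcs e by (simp add: h_def)
  next
    fix z assume z: "z \<in> parcs (Dvec k)"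
    obtain a b where ab: "z = (a, b)" by (cases z)
    have "a \<in> g ` verts D" "b \<in> g ` verts D"
      using z assms(3) by (auto simp: ab parcs_Dvec)
    then obtain u v where uv: "u \<in> verts D" "v \<in> verts D" "a = g u" "b = g v" by blast
    then have "(u, v) \<in> arcs_ends D" using arcs z ab by blast
    then show "z \<in> h ` arcs D" using uv ab by (force simp: arcs_ends_conv h_def)
  qed
  then have "with_proj (Dvec k) = app_iso f D"
    using assms(3) by (simp add: app_iso_def f_def with_proj_def Dvec_def)
  ultimately show ?thesis
    using assms(4) unfolding digraph_iso_on_def by (intro exI[of _ f]) (simp add: f_def)
qed

section \<open>The equivalence for super-orientations\<close>

theorem theorem4:
  fixes D :: "('a, 'b) pre_digraph" and x :: "nat \<Rightarrow> 'a" and k :: nat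
  assumes "k \<ge> 2"
    and "inj_on x {..2 * k}"
    and "super_orientation D (complement_graph (cycle_graph (2 * k + 1) x))"
  shows "(\<exists>P. path_partition D P \<and> orthogonal_paths P {x 0, x (2 * k)}) \<longleftrightarrow>
         \<not> digraph_iso_on D {x 0, x (2 * k)} (with_proj (Dvec k)) {0, 2 * k}"
proof -
  let ?G = "complement_graph (cycle_graph (2 * k + 1) x)"
  let ?S = "{x 0, x (2 * k)}"
  define A where "A a b \<longleftrightarrow> (x a, x b) \<in> arcs_ends D" for a b
  interpret digraph D using assms(3) by (simp add: super_orientation_def)
  have sym: "mk_symmetric D = ?G" using assms(3) by (simp add: super_orientation_def)
  have verts: "verts D = x ` {..2 * k}"
    using arg_cong[OF sym, of pverts]
    by (simp add: complement_graph_def cycle_graph_def lessThan_Suc_atMost)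
  have "parcs (mk_symmetric D) = {(u, v). (u, v) \<in> arcs_ends D \<or> (v, u) \<in> arcs_ends D}"
    by (auto simp: parcs_mk_symmetric arcs_ends_conv)
  then have A_iff: "A a b \<or> A b a \<longleftrightarrow> a + 2 \<le> b \<and> (0 < a \<or> b < 2 * k)"
    if "a < b" "b \<le> 2 * k" for a b
    using parcs_cycle_complement[OF assms(2) that] by (simp add: sym A_def)
  have loop: "\<not> A a a" for a
    using no_loops unfolding A_def arcs_ends_conv by fastforce
  have "digraph_iso_on D ?S (with_proj (Dvec k)) {0, 2 * k}"
    if no_P: "\<not> (\<exists>P. path_partition D P \<and> orthogonal_paths P ?S)"
  proof -
    have path: "\<exists>p. vpath p D \<and> set p = x ` X" if "traceable A X" "X \<subseteq> {..2 * k}" "X \<noteq> {}" for X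
    proof -
      obtain p where p: "distinct p" "successively A p" "set p = X"
        using \<open>traceable A X\<close> by (auto simp: traceable_def)
      then have "vpath (map x p) D"
        using that verts inj_on_subset[OF assms(2)]
        by (auto simp: vpath_iff_successively successively_map A_def[abs_def] distinct_map)
      then show ?thesis using p(3) by (intro exI[of _ "map x p"]) simp
    qed
    interpret unpartitioned A k
    proof
      fix a b assume "a + 2 \<le> b" "b \<le> 2 * k" "0 < a \<or> b < 2 * k"
      then show "A a b \<or> A b a" using A_iff[of a b] by simp
    next
      fix X Y assume XY: "X \<inter> Y = {}" "X \<union> Y = {..2 * k}" "0 \<in> X" "2 * k \<in> Y"
        "traceable A X" "traceable A Y"
      obtain p where p: "vpath p D" "set p = x ` X" using path[OF XY(5)] XY(2,3) by blast
      obtain q where q: "vpath q D" "set q = x ` Y" using path[OF XY(6)] XY(2,4) by blast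
      have "x ` X \<inter> x ` Y = {}"
        using inj_on_image_Int[OF assms(2), of X Y] XY(1,2) by auto
      then show False
        using no_P path_partition_pairI[OF p(1) q(1), of "x 0" "x (2 * k)"] XY(2-4)
        by (auto simp: p(2) q(2) verts image_Un[symmetric])
    qed
    define y where "y = inv_into {..2 * k} x"
    have y: "y (x a) = a" if "a \<le> 2 * k" for a
      using that assms(2) by (simp add: y_def)
    \<comment> \<open>If all arcs decrease the index, reversing the labels turns \<open>D\<close>
      into \<open>Dvec k\<close>; the reversal swaps \<open>0\<close> and \<open>2k\<close>, so the
      distinguished set is kept.\<close>
    define r where "r a = (if A 0 2 then a else 2 * k - a)" for a
    have "(x a, x b) \<in> arcs_ends D \<longleftrightarrow> (r a, r b) \<in> parcs (Dvec k)"
      if "a \<le> 2 * k" "b \<le> 2 * k" for a b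
    proof (rule linorder_cases[of a b])
      assume ab: "a < b"
      show ?thesis
      proof (cases "a + 2 \<le> b \<and> (0 < a \<or> b < 2 * k)")
        case True
        then show ?thesis
          using all_arcs_same_direction(1)[of a b] that by (auto simp: A_def r_def parcs_Dvec)
      next
        case False
        then show ?thesis
          using A_iff[OF ab that(2)] ab that by (auto simp: A_def r_def parcs_Dvec)
      qed
    next
      assume ab: "b < a"
      show ?thesis
      proof (cases "b + 2 \<le> a \<and> (0 < b \<or> a < 2 * k)")
        case True
        then show ?thesis
          using all_arcs_same_direction(2)[of b a] that by (auto simp: A_def r_def parcs_Dvec)
      next
        case False
        then show ?thesis
          using A_iff[OF ab that(1)] ab that by (auto simp: A_def r_def parcs_Dvec)
      qed
    next
      assume "a = b"
      then show ?thesis using loop[of a] by (auto simp: A_def parcs_Dvec)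
    qed
    moreover have "bij_betw r {..2 * k} {..2 * k}"
      by (rule bij_betw_byWitness[where f' = r]) (auto simp: r_def)
    then have "r ` {..2 * k} = {..2 * k}" "inj_on r {..2 * k}"
      by (auto simp: bij_betw_def)
    moreover have "r ` {0, 2 * k} = {0, 2 * k}" by (auto simp: r_def)
    ultimately show ?thesis
      using y by (intro iso_DvecI[where g = "\<lambda>u. r (y u)"] digraph_axioms)
        (auto simp: verts inj_on_def image_image)
  qed
  moreover have False
    if "digraph_iso_on D ?S (with_proj (Dvec k)) {0, 2 * k}"
      and P: "path_partition D P" "orthogonal_paths P ?S" for P
  proof -
    obtain g where "inj_on g (verts D)" "g ` verts D = {..2 * k}" "g ` ?S = {0, 2 * k}"
      "\<And>u v. (u, v) \<in> arcs_ends D \<Longrightarrow> g u + 2 \<le> g v"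
      using iso_Dvec_increasing[OF \<open>digraph_iso_on D ?S (with_proj (Dvec k)) {0, 2 * k}\<close>] by metis
    then show False
      using no_partition_if_increasing[OF P, of g k] assms(1) by (auto simp: verts)
  qed
  ultimately show ?thesis by blast
qed

end
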